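(* Let $n\ge2$, let $q$ be a prime power and $\mathbb{V}_0=\mathbb{F}_q^n$. Let $\varphi$ be a graph automorphism of $\mathbf{SIG}(\mathbb{V}_0)$. Then the restriction $\varphi|_{\mathbb{P}^{n-1}(\mathbb{F}_q)}$ of $\varphi$ to the part $\mathbb{P}^{n-1}(\mathbb{F}_q)$ is a collineation.
   Context: $\mathbb{F}_q$ is the finite field with $q$ elements and $\mathbb{V}_0=\mathbb{F}_q^n$ is the space of column vectors. $E_n(\mathbb{F}_q)$ is the set of nonzero matrices $M\in M_n(\mathbb{F}_q)$ having at least one eigenvector in $\mathbb{V}_0$ (a nonzero $v$ with $Mv=\lambda v$ for some $\lambda\in\mathbb{F}_q$; $\lambda=0$ allowed). $\mathcal{E}^{n-1}(\mathbb{F}_q)=\{\langle M\rangle: M\in E_n(\mathbb{F}_q)\}$ is the set of one-dimensional subspaces of $M_n(\mathbb{F}_q)$ generated by elements of $E_n(\mathbb{F}_q)$, and $\mathbb{P}^{n-1}(\mathbb{F}_q)$ is the set of one-dimensional subspaces $\langle v\rangle$ of $\mathbb{V}_0$. The spectral incidence graph $\mathbf{SIG}(\mathbb{V}_0)$ is the simple bipartite graph with vertex set the disjoint union $\mathcal{E}^{n-1}(\mathbb{F}_q)\cup\mathbb{P}^{n-1}(\mathbb{F}_q)$ in which $\langle M\rangle$ and $\langle v\rangle$ are adjacent iff $v$ is an eigenvector of $M$. A graph automorphism is a permutation of the whole vertex set preserving adjacency in both directions. A bijection $f:\mathbb{P}(V)\to\mathbb{P}(V)$ on the set $\mathbb{P}(V)$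 of one-dimensional subspaces of a finite-dimensional vector space $V$ is a collineation (preserves collinearity) if for every three distinct $L_1,L_2,L_3\in\mathbb{P}(V)$: $L_3\subseteq L_1+L_2\iff f(L_3)\subseteq f(L_1)+f(L_2)$. *)

theory Defs
  imports "HOL-Analysis.Analysis"
begin

definition projective_space :: "('k::field \<Rightarrow> 'b::ab_group_add \<Rightarrow> 'b) \<Rightarrow> 'b set set" where
  "projective_space s = {L. module.subspace s L \<and> vector_space.dim s L = 1}"

definition collineation ::
  "('k::field \<Rightarrow> 'b::ab_group_add \<Rightarrow> 'b) \<Rightarrow> ('b set \<Rightarrow> 'b set) \<Rightarrow> bool" where
  "collineation s f \<longleftrightarrow>
     bij_betw f (projective_space s) (projective_space s) \<and>
     (\<forall>L1\<in>projective_space s. \<forall>L2\<in>projective_space s. \<forall>L3\<in>projective_space s.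
        distinct [L1, L2, L3] \<longrightarrow>
        (L3 \<subseteq> {x + y | x y. x \<in> L1 \<and> y \<in> L2} \<longleftrightarrow>
         f L3 \<subseteq> {x + y | x y. x \<in> f L1 \<and> y \<in> f L2}))"

text \<open>The library provides the vector space structure only for column vectors, as
  \<open>vec\<close>; here is the one on matrices.\<close>

definition matrix_scale :: "'a::times \<Rightarrow> 'a^'m^'n \<Rightarrow> 'a^'m^'n" where
  "matrix_scale c M = (\<chi> i j. c * M $ i $ j)"

interpretation matvec: vector_space "matrix_scale :: 'a::field \<Rightarrow> 'a^'m^'n \<Rightarrow> 'a^'m^'n"
  by unfold_locales (simp_all add: matrix_scale_def vec_eq_iff algebra_simps)

definition eigenvector :: "'a::field^'n^'n \<Rightarrow> 'a^'n \<Rightarrow> bool" where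
  "eigenvector M v \<longleftrightarrow> v \<noteq> 0 \<and> (\<exists>c. M *v v = c *s v)"

definition eigen_matrices :: "('a::field^'n^'n) set" where
  "eigen_matrices = {M. M \<noteq> 0 \<and> (\<exists>v. eigenvector M v)}"

type_synonym ('a, 'n) sig_vertex = "('a^'n^'n) set + ('a^'n) set"

text \<open>A simple graph is given by its vertex set and its set of edges, which are
  two-element sets of vertices.\<close>

definition sig_verts :: "('a::field, 'n::finite) sig_vertex set" where
  "sig_verts = (\<lambda>M. matvec.span {M}) ` eigen_matrices <+> projective_space (*s)"

definition sig_edges :: "('a::field, 'n::finite) sig_vertex set set" where
  "sig_edges = {{Inl (matvec.span {M}), Inr (vec.span {v})} | M v.
     M \<in> eigen_matrices \<and> eigenvector M v}"

definition graph_automorphism :: "'v set \<Rightarrow> 'v set set \<Rightarrow> ('v \<Rightarrow> 'v) \<Rightarrow> bool" where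
  "graph_automorphism V E \<phi> \<longleftrightarrow>
     bij_betw \<phi> V V \<and> (\<forall>x\<in>V. \<forall>y\<in>V. {x, y} \<in> E \<longleftrightarrow> {\<phi> x, \<phi> y} \<in> E)"

end

theory Submission
  imports Defs
begin

text \<open>
  Write \<open>q\<close> for the number of scalars and call the points spanned by eigenvectors of \<open>M\<close> the
  eigenpoints of \<open>M\<close>; they are the neighbours of the vertex \<open>\<langle>M\<rangle>\<close>. The idea is that projective
  lines can be read off the graph by counting: the lines are exactly the sets of eigenpoints that
  have \<open>q + 1\<close> elements.

  If \<open>M\<close> has \<open>q + 1\<close> eigenpoints, then two of them belong to the same one of the \<open>q\<close> possible
  eigenvalues. The whole line through these two lies in the eigenspace, and since a line
  has \<open>q + 1\<close> points (\<open>card_points_on_line\<close>), it is the whole set of eigenpoints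
  (\<open>eigenpoints_line_if_card\<close>). Conversely, given a line, take a basis \<open>b\<^sub>0, b\<^sub>1, b\<^sub>2, \<dots>\<close> of the space
  whose first two vectors span it. The shift that kills \<open>b\<^sub>0, b\<^sub>1\<close> and sends \<open>b\<^sub>i\<close> to \<open>b\<^sub>i\<^sub>-\<^sub>1\<close>
  for \<open>i \<ge> 2\<close> is nilpotent with the line as its kernel, so its eigenpoints are the points of the
  line (\<open>exists_shift\<close>, \<open>line_is_eigenpoints\<close>). Hence \<open>L\<^sub>3\<close> lies on the line through two distinct
  points \<open>L\<^sub>1, L\<^sub>2\<close> iff some matrix vertex of degree \<open>q + 1\<close> is adjacent to all three
  (\<open>collinear_iff_eigenpoints\<close>).

  This criterion is invariant under automorphisms that map points to points, and all automorphisms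
  do (\<open>sig_automorphism_points\<close>): the vertex of the identity matrix is adjacent to every point, and
  if the two parts were exchanged, its image would be a common eigenpoint of all vertices in
  the matrix part. No point has this property (\<open>exists_eigenpoints_avoiding\<close>).
\<close>

definition eigenpoints :: "'a::field^'n^'n \<Rightarrow> ('a^'n) set set" where
  "eigenpoints M = {vec.span {v} | v. eigenvector M v}"

definition points_on :: "('a::field^'n) set \<Rightarrow> ('a^'n) set set" where
  "points_on S = {vec.span {x} | x. x \<in> S \<and> x \<noteq> 0}"

section \<open>Points and lines\<close>

lemma span_singleton_cong:
  fixes u v :: "'a::field^'n"
  assumes "v \<in> vec.span {u}" "v \<noteq> 0"
  shows "vec.span {v} = vec.span {u}"
proof -
  obtain k where k: "v = k *s u"
    using assms(1) by (auto simp: vec.span_singleton)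
  with assms(2) have "k \<noteq> 0" by auto
  then have "u = inverse k *s v" by (simp add: k vector_smult_assoc)
  then have "u \<in> vec.span {v}" by (metis vec.span_base vec.span_scale insertI1)
  then show ?thesis
    using assms(1) by (intro vec.span_eq[THEN iffD2]) auto
qed

lemma projective_space_iff:
  fixes L :: "('a::field^'n) set"
  shows "L \<in> projective_space (*s) \<longleftrightarrow> (\<exists>v. v \<noteq> 0 \<and> L = vec.span {v})"
proof
  assume "L \<in> projective_space (*s)"
  then have L: "vec.subspace L" "vec.dim L = 1" by (auto simp: projective_space_def)
  obtain B where B: "B \<subseteq> L" "vec.independent B" "L \<subseteq> vec.span B" "card B = vec.dim L"
    by (rule vec.basis_exists)
  obtain v where v: "B = {v}" using B(4) L(2) by (auto simp: card_1_singleton_iff)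
  have "v \<noteq> 0" using B(2) v by (auto simp: vec.dependent_zero)
  moreover have "L = vec.span {v}"
    using B(1,3) v L(1) vec.span_minimal by blast
  ultimately show "\<exists>v. v \<noteq> 0 \<and> L = vec.span {v}" by blast
next
  assume "\<exists>v. v \<noteq> 0 \<and> L = vec.span {v}"
  then obtain v where v: "v \<noteq> 0" "L = vec.span {v}" by blast
  have "vec.independent {v}" using v(1) by (simp add: vec.dependent_single)
  then have "vec.dim L = 1" using v(2) vec.dim_span_eq_card_independent by fastforce
  then show "L \<in> projective_space (*s)"
    by (simp add: projective_space_def v(2) vec.subspace_span)
qed

lemma independent_pairI:
  fixes u v :: "'a::field^'n"
  assumes "u \<noteq> 0" "v \<noteq> 0" "vec.span {u} \<noteq> vec.span {v}"
  shows "u \<noteq> v" "vec.independent {u, v}"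
proof -
  show "u \<noteq> v" using assms by auto
  have "u \<notin> vec.span {v}" using assms span_singleton_cong by blast
  then show "vec.independent {u, v}"
    using assms(2) by (simp add: vec.independent_insert)
qed

lemma span_pair_sums:
  fixes u v :: "'a::field^'n"
  shows "{x + y | x y. x \<in> vec.span {u} \<and> y \<in> vec.span {v}} = vec.span {u, v}"
  using vec.span_Un[of "{u}" "{v}"] by (auto simp: insert_commute)

text \<open>The points of the line are \<open>\<langle>v\<rangle>\<close>, the point at infinity, and the affine points
  \<open>\<langle>u + a v\<rangle>\<close>, one for each scalar \<open>a\<close>.\<close>

lemma card_points_on_line:
  fixes u v :: "'a::{field,finite}^'n"
  assumes "u \<noteq> v" "vec.independent {u, v}"
  shows "card (points_on (vec.span {u, v})) = CARD('a) + 1"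
proof -
  have u: "u \<notin> vec.span {v}" and v: "v \<noteq> 0"
    using assms by (auto simp: vec.independent_insert)
  have eq: "points_on (vec.span {u, v}) =
      insert (vec.span {v}) (range (\<lambda>a. vec.span {u + a *s v}))"
  proof (intro equalityI subsetI)
    fix L assume "L \<in> points_on (vec.span {u, v})"
    then obtain x where x: "x \<in> vec.span {u, v}" "x \<noteq> 0" "L = vec.span {x}"
      by (auto simp: points_on_def)
    then obtain k l where "x - k *s u = l *s v"
      unfolding vec.span_breakdown_eq vec.span_singleton by blast
    then have kl: "x = k *s u + l *s v" by (metis add.commute diff_add_cancel)
    show "L \<in> insert (vec.span {v}) (range (\<lambda>a. vec.span {u + a *s v}))"
    proof (cases "k = 0")
      case True
      then have "x \<in> vec.span {v}" by (auto simp: kl vec.span_singleton)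
      then show ?thesis using x span_singleton_cong by blast
    next
      case False
      then have "x = k *s (u + (l / k) *s v)"
        by (simp add: kl vector_add_ldistrib vector_smult_assoc)
      then have "x \<in> vec.span {u + (l / k) *s v}"
        unfolding vec.span_singleton by (rule range_eqI)
      then show ?thesis using x span_singleton_cong by blast
    qed
  next
    have nz: "u + a *s v \<noteq> 0" for a
    proof
      assume "u + a *s v = 0"
      then have "u = (- a) *s v" by (simp add: eq_neg_iff_add_eq_0)
      then have "u \<in> vec.span {v}" unfolding vec.span_singleton by (rule range_eqI)
      then show False using u by simp
    qed
    have "v \<in> vec.span {u, v}" "u + a *s v \<in> vec.span {u, v}" for a
      by (auto intro!: vec.span_add vec.span_scale intro: vec.span_base)
    then show "L \<in> points_on (vec.span {u, v})"
      if "L \<in> insert (vec.span {v}) (range (\<lambda>a. vec.span {u + a *s v}))" for L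
      using that nz v unfolding points_on_def by blast
  qed
  have ratio: "a = b" if "u + a *s v = k *s (u + b *s v)" for a b k
  proof -
    have e: "(1 - k) *s u = (k * b - a) *s v"
      using that by (simp add: vec_eq_iff algebra_simps)
    have k: "k = 1"
    proof (rule ccontr)
      assume "k \<noteq> 1"
      then have "inverse (1 - k) * (1 - k) = 1" by simp
      then have "u = inverse (1 - k) *s ((1 - k) *s u)"
        by (metis vector_smult_assoc vector_smult_lid)
      also have "\<dots> = (inverse (1 - k) * (k * b - a)) *s v"
        unfolding e by (rule vector_smult_assoc)
      finally have "u \<in> vec.span {v}" unfolding vec.span_singleton by (rule range_eqI)
      then show False using u by simp
    qed
    then have "k * b - a = 0" using e v by simp
    then show ?thesis using k by simp
  qed
  have "inj (\<lambda>a. vec.span {u + a *s v})"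
  proof (rule injI)
    fix a b assume "vec.span {u + a *s v} = vec.span {u + b *s v}"
    then have "u + a *s v \<in> vec.span {u + b *s v}" by (metis vec.span_base insertI1)
    then obtain k where "u + a *s v = k *s (u + b *s v)" by (auto simp: vec.span_singleton)
    from ratio[OF this] show "a = b" .
  qed
  then have "card (range (\<lambda>a. vec.span {u + a *s v})) = CARD('a)"
    by (rule card_image)
  moreover have "vec.span {v} \<notin> range (\<lambda>a. vec.span {u + a *s v})"
  proof
    assume "vec.span {v} \<in> range (\<lambda>a. vec.span {u + a *s v})"
    then obtain a where "vec.span {v} = vec.span {u + a *s v}" by blast
    then have "u + a *s v \<in> vec.span {v}" by (metis vec.span_base insertI1)
    then have "u \<in> vec.span {v}"
      by (metis add_diff_cancel_right' vec.span_diff vec.span_scale vec.span_base insertI1)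
    then show False using u by simp
  qed
  ultimately show ?thesis unfolding eq by simp
qed

section \<open>Lines as sets of eigenpoints\<close>

text \<open>In a basis \<open>b\<^sub>0 = u, b\<^sub>1 = v, b\<^sub>2, \<dots>\<close> the map \<open>f\<close> kills \<open>u\<close> and \<open>v\<close> and lowers the index of the
  others by one. It maps the span \<open>S\<^sub>k\<close> of the first \<open>k\<close> basis vectors into the span of one fewer,
  so an eigenvector can be pushed down this flag until it reaches \<open>S\<^sub>2\<close>, the span of \<open>u\<close> and \<open>v\<close>.\<close>

lemma exists_shift:
  fixes u v :: "'a::field^'n"
  assumes "u \<noteq> v" "vec.independent {u, v}"
  obtains f :: "'a^'n \<Rightarrow> 'a^'n" where "Vector_Spaces.linear (*s) (*s) f" "f u = 0" "f v = 0"
    "\<And>x c. f x = c *s x \<Longrightarrow> x \<in> vec.span {u, v}"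
proof -
  obtain B where B: "{u, v} \<subseteq> B" "vec.independent B" "UNIV \<subseteq> vec.span B"
    by (rule vec.maximal_independent_subset_extend[OF subset_UNIV assms(2)])
  have fin: "finite (B - {u, v})" using B(2) vec.finiteI_independent by blast
  obtain xs where xs: "set xs = B - {u, v}" "distinct xs"
    using finite_distinct_list[OF fin] by blast
  define b where "b i = (u # v # xs) ! i" for i
  define n where "n = length xs + 2"
  have inj: "inj_on b {..<n}"
    using assms(1) xs unfolding b_def n_def by (intro inj_on_nth) auto
  have img: "b ` {..<n} = B"
  proof -
    have "b ` {..<n} = set (u # v # xs)"
      unfolding b_def n_def by (auto simp: set_conv_nth simp del: set_simps nth_Cons_Suc)
    then show ?thesis using B(1) xs(1) by auto
  qed
  define g where
    "g x = (let i = the_inv_into {..<n} b x in if i < 2 then 0 else b (i - 1))" for x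
  obtain f :: "'a^'n \<Rightarrow> 'a^'n" where f: "Vector_Spaces.linear (*s) (*s) f"
      and fg: "\<And>x. x \<in> B \<Longrightarrow> f x = g x"
    using vec.linear_independent_extend[OF B(2)] by blast
  interpret f: Vector_Spaces.linear "(*s)" "(*s)" f by (rule f)
  have fb: "f (b i) = (if i < 2 then 0 else b (i - 1))" if "i < n" for i
    using that fg[of "b i"] img the_inv_into_f_f[OF inj, of i] by (auto simp: g_def Let_def)
  have b01: "b 0 = u" "b 1 = v" by (auto simp: b_def)
  have down: "f x \<in> vec.span (b ` {..<k})" if "x \<in> vec.span (b ` {..<Suc k})" "k < n" for x k
  proof -
    have "f ` b ` {..<Suc k} \<subseteq> vec.span (b ` {..<k})"
    proof clarsimp
      fix i assume "i < Suc k"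
      then show "f (b i) \<in> vec.span (b ` {..<k})"
        using that(2) fb[of i] by (auto intro!: vec.span_base vec.span_zero)
    qed
    then have "vec.span (f ` b ` {..<Suc k}) \<subseteq> vec.span (b ` {..<k})"
      by (simp add: vec.span_minimal vec.subspace_span)
    then show ?thesis using that(1) f.span_image by blast
  qed
  have bk: "b k \<notin> vec.span (b ` {..<k})" if "k < n" for k
  proof -
    have "b ` {..<k} \<subseteq> B - {b k}" using inj img that by (force simp: inj_on_def)
    moreover have "b k \<in> B" using img that by auto
    ultimately show ?thesis
      using B(2) vec.span_mono unfolding vec.dependent_def by blast
  qed
  \<comment> \<open>Let \<open>x\<close> be an eigenvector in \<open>S\<^sub>k\<^sub>+\<^sub>3\<close>. If \<open>c \<noteq> 0\<close>, then \<open>x = f x / c\<close> lies in \<open>S\<^sub>k\<^sub>+\<^sub>2\<close>; if \<open>c = 0\<close>, the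
    coefficient of \<open>b\<^sub>k\<^sub>+\<^sub>2\<close> in \<open>x\<close> is that of \<open>b\<^sub>k\<^sub>+\<^sub>1\<close> in \<open>f x\<close> and therefore vanishes.\<close>
  have descend: "x \<in> vec.span {u, v}"
    if "k + 2 \<le> n" "x \<in> vec.span (b ` {..<k + 2})" "f x = c *s x" for x c k
    using that
  proof (induction k)
    case 0
    have "b ` {..<0 + 2} = {u, v}" using b01 by (simp add: lessThan_Suc numeral_2_eq_2 insert_commute)
    then show ?case using 0(2) by simp
  next
    case (Suc k)
    let ?S = "\<lambda>k. vec.span (b ` {..<k})"
    have "x \<in> ?S (k + 2)"
    proof (cases "c = 0")
      case False
      have "f x \<in> ?S (k + 2)" using down[of x "k + 2"] Suc.prems by simp
      then have "inverse c *s f x \<in> ?S (k + 2)" by (rule vec.span_scale)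
      then show ?thesis using False Suc.prems(3) by (simp add: vector_smult_assoc)
    next
      case True
      have "b ` {..<Suc k + 2} = insert (b (k + 2)) (b ` {..<k + 2})"
        by (simp add: lessThan_Suc)
      then obtain a where a: "x - a *s b (k + 2) \<in> ?S (k + 2)"
        using Suc.prems(2) vec.span_breakdown_eq by metis
      have "f (x - a *s b (k + 2)) \<in> ?S (k + 1)"
        using down[of _ "k + 1"] a Suc.prems(1) by simp
      moreover have "f (x - a *s b (k + 2)) = - (a *s b (k + 1))"
        using Suc.prems(1,3) True fb[of "k + 2"] by (simp add: f.diff f.scale)
      ultimately have ab: "a *s b (k + 1) \<in> ?S (k + 1)"
        using vec.span_neg by fastforce
      have "a = 0"
      proof (rule ccontr)
        assume "a \<noteq> 0"
        then have "b (k + 1) = inverse a *s (a *s b (k + 1))" by (simp add: vector_smult_assoc)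
        then have "b (k + 1) \<in> ?S (k + 1)" using ab vec.span_scale by metis
        then show False using bk[of "k + 1"] Suc.prems(1) by simp
      qed
      then show ?thesis using a by simp
    qed
    then show ?case using Suc by simp
  qed
  have "x \<in> vec.span {u, v}" if "f x = c *s x" for x c
    using descend[of "n - 2" x c] that img B(3) by (auto simp: n_def)
  moreover have "f u = 0" "f v = 0"
    using fb[of 0] fb[of 1] b01 by (auto simp: n_def)
  ultimately show ?thesis using that f by blast
qed

text \<open>Adding the identity to the shift changes no eigenvector and makes the matrix nonzero even
  in dimension two, where the shift itself is zero.\<close>

lemma line_is_eigenpoints:
  fixes u v :: "'a::field^'n"
  assumes "u \<noteq> v" "vec.independent {u, v}"
  obtains M where "M \<in> eigen_matrices" "eigenpoints M = points_on (vec.span {u, v})"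
proof -
  obtain f :: "'a^'n \<Rightarrow> 'a^'n" where f: "Vector_Spaces.linear (*s) (*s) f"
    and fuv: "f u = 0" "f v = 0"
    and fc: "\<And>x c. f x = c *s x \<Longrightarrow> x \<in> vec.span {u, v}"
    using exists_shift[OF assms] by metis
  interpret f: Vector_Spaces.linear "(*s)" "(*s)" f by (rule f)
  define M where "M = matrix (\<lambda>x. x + f x)"
  have "Vector_Spaces.linear (*s) (*s) (\<lambda>x. x + f x)"
    by unfold_locales (simp_all add: f.add f.scale vec.scale_right_distrib)
  then have M: "M *v x = x + f x" for x unfolding M_def by (rule matrix_works)
  have ker: "f x = 0" if "x \<in> vec.span {u, v}" for x
    using that by (rule vec.span_induct_alt) (auto simp: f.add f.scale fuv f.zero)
  have ev: "eigenvector M x \<longleftrightarrow> x \<noteq> 0 \<and> x \<in> vec.span {u, v}" for x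
  proof
    assume "eigenvector M x"
    then obtain c where "x \<noteq> 0" "x + f x = c *s x" by (auto simp: eigenvector_def M)
    moreover from this have "f x = (c - 1) *s x"
      by (simp add: vec.scale_left_diff_distrib algebra_simps)
    ultimately show "x \<noteq> 0 \<and> x \<in> vec.span {u, v}" using fc by blast
  next
    assume "x \<noteq> 0 \<and> x \<in> vec.span {u, v}"
    then show "eigenvector M x" using ker[of x] by (auto simp: eigenvector_def M intro: exI[of _ 1])
  qed
  have u: "u \<noteq> 0" using assms(2) vec.dependent_zero by (metis insertI1)
  then have "eigenvector M u" by (simp add: ev vec.span_base)
  moreover have "M \<noteq> 0" using M[of u] u fuv by auto
  ultimately have "M \<in> eigen_matrices" by (auto simp: eigen_matrices_def)
  then show ?thesis using that ev by (auto simp: eigenpoints_def points_on_def)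
qed

text \<open>There are fewer eigenvalues than eigenpoints, so two eigenpoints share an eigenvalue and
  the line through them consists of eigenpoints. It has as many points as there are eigenpoints.\<close>

lemma eigenpoints_line_if_card:
  fixes M :: "'a::{field,finite}^'n^'n"
  assumes "card (eigenpoints M) = CARD('a) + 1"
  obtains x y where "x \<noteq> y" "vec.independent {x, y}"
    "eigenpoints M = points_on (vec.span {x, y})"
proof -
  have "\<forall>L\<in>eigenpoints M. \<exists>v c. eigenvector M v \<and> L = vec.span {v} \<and> M *v v = c *s v"
    by (auto simp: eigenpoints_def eigenvector_def)
  then obtain r c where r: "\<And>L. L \<in> eigenpoints M \<Longrightarrow>
      eigenvector M (r L) \<and> L = vec.span {r L} \<and> M *v r L = c L *s r L"
    by metis
  have "card (c ` eigenpoints M) \<le> CARD('a)" by (simp add: card_mono)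
  then have "\<not> inj_on c (eigenpoints M)" using assms by (auto dest: card_image)
  then obtain K L where KL: "K \<in> eigenpoints M" "L \<in> eigenpoints M" "K \<noteq> L" "c K = c L"
    by (auto simp: inj_on_def)
  let ?x = "r K" and ?y = "r L"
  have ind: "?x \<noteq> ?y" "vec.independent {?x, ?y}"
    using independent_pairI[of ?x ?y] r[OF KL(1)] r[OF KL(2)] KL(3)
    by (auto simp: eigenvector_def)
  have "M *v z = c K *s z" if "z \<in> vec.span {?x, ?y}" for z
    using that
    by (rule vec.span_induct_alt)
      (use r[OF KL(1)] r[OF KL(2)] KL(4) in
        \<open>auto simp: matrix_vector_right_distrib vec.scale_right_distrib vector_scalar_commute
          vector_smult_assoc mult.commute\<close>)
  then have sub: "points_on (vec.span {?x, ?y}) \<subseteq> eigenpoints M"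
    by (auto simp: points_on_def eigenpoints_def eigenvector_def)
  have "finite (eigenpoints M)" using assms card.infinite by fastforce
  then have "eigenpoints M = points_on (vec.span {?x, ?y})"
    using sub card_points_on_line[OF ind] assms by (metis card_subset_eq)
  then show ?thesis using that ind by blast
qed

text \<open>The right-hand side speaks only of adjacency and vertex degrees.\<close>

lemma collinear_iff_eigenpoints:
  fixes L1 L2 L3 :: "('a::{field,finite}^'n) set"
  assumes "L1 \<in> projective_space (*s)" "L2 \<in> projective_space (*s)" "L3 \<in> projective_space (*s)"
    and "L1 \<noteq> L2"
  shows "L3 \<subseteq> {x + y | x y. x \<in> L1 \<and> y \<in> L2} \<longleftrightarrow>
    (\<exists>M\<in>eigen_matrices. card (eigenpoints M) = CARD('a) + 1 \<and> {L1, L2, L3} \<subseteq> eigenpoints M)"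
proof -
  obtain u v w where uvw: "u \<noteq> 0" "L1 = vec.span {u}" "v \<noteq> 0" "L2 = vec.span {v}"
      "w \<noteq> 0" "L3 = vec.span {w}"
    using assms(1-3) unfolding projective_space_iff by blast
  have ind: "u \<noteq> v" "vec.independent {u, v}"
    using independent_pairI uvw assms(4) by blast+
  have "L3 \<subseteq> {x + y | x y. x \<in> L1 \<and> y \<in> L2} \<longleftrightarrow> w \<in> vec.span {u, v}"
    unfolding uvw span_pair_sums
    by (metis empty_subsetI insert_subset vec.span_base insertI1 subsetD vec.span_minimal vec.subspace_span)
  also have "\<dots> \<longleftrightarrow>
    (\<exists>M\<in>eigen_matrices. card (eigenpoints M) = CARD('a) + 1 \<and> {L1, L2, L3} \<subseteq> eigenpoints M)"
  proof
    assume w: "w \<in> vec.span {u, v}"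
    obtain M where M: "M \<in> eigen_matrices" "eigenpoints M = points_on (vec.span {u, v})"
      by (rule line_is_eigenpoints[OF ind])
    have "u \<in> vec.span {u, v}" "v \<in> vec.span {u, v}" by (auto intro: vec.span_base)
    then have "{L1, L2, L3} \<subseteq> eigenpoints M"
      using w uvw unfolding M(2) points_on_def by blast
    then show "\<exists>M\<in>eigen_matrices. card (eigenpoints M) = CARD('a) + 1 \<and>
        {L1, L2, L3} \<subseteq> eigenpoints M"
      using M card_points_on_line[OF ind] by metis
  next
    assume "\<exists>M\<in>eigen_matrices. card (eigenpoints M) = CARD('a) + 1 \<and>
        {L1, L2, L3} \<subseteq> eigenpoints M"
    then obtain M where M: "card (eigenpoints M) = CARD('a) + 1" "{L1, L2, L3} \<subseteq> eigenpoints M"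
      by blast
    obtain x y where xy: "x \<noteq> y" "vec.independent {x, y}"
        "eigenpoints M = points_on (vec.span {x, y})"
      by (rule eigenpoints_line_if_card[OF M(1)])
    have in_line: "z \<in> vec.span {x, y}" if z: "vec.span {z} \<in> eigenpoints M" for z
    proof -
      obtain z' where z': "z' \<in> vec.span {x, y}" "vec.span {z} = vec.span {z'}"
        using z unfolding xy(3) points_on_def by blast
      have "z \<in> vec.span {z'}" using z'(2) vec.span_base[of z "{z}"] by auto
      also have "\<dots> \<subseteq> vec.span {x, y}" using z'(1) by (simp add: vec.span_minimal)
      finally show ?thesis .
    qed
    then have uvw': "{u, v} \<subseteq> vec.span {x, y}" "w \<in> vec.span {x, y}" using M(2) uvw by auto
    have "vec.dim (vec.span {x, y}) = card {u, v}"
      using xy(1,2) ind(1) vec.dim_span_eq_card_independent[OF xy(2)] by simp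
    then have "vec.span {x, y} \<subseteq> vec.span {u, v}"
      by (intro vec.card_ge_dim_independent uvw'(1) ind(2)) simp
    then show "w \<in> vec.span {u, v}" using uvw'(2) by blast
  qed
  finally show ?thesis .
qed

section \<open>Automorphisms of the spectral incidence graph\<close>

text \<open>Membership in \<open>sig_edges\<close> only provides some generator \<open>M'\<close> of the same line of matrices;
  \<open>M\<close> is a multiple of it and so inherits its eigenvectors.\<close>

lemma sig_edge_iff:
  fixes M :: "'a::field^'n^'n"
  assumes "M \<in> eigen_matrices"
  shows "{Inl (matvec.span {M}), Inr L} \<in> sig_edges \<longleftrightarrow> L \<in> eigenpoints M"
proof
  assume "L \<in> eigenpoints M"
  then show "{Inl (matvec.span {M}), Inr L} \<in> sig_edges"
    using assms by (auto simp: sig_edges_def eigenpoints_def)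
next
  assume "{Inl (matvec.span {M}), Inr L} \<in> sig_edges"
  then obtain M' v where M': "matvec.span {M} = matvec.span {M'}" "L = vec.span {v}"
      "eigenvector M' v"
    by (auto simp: sig_edges_def doubleton_eq_iff)
  have "M \<in> matvec.span {M'}" using M'(1) matvec.span_base by blast
  then obtain k where k: "M = matrix_scale k M'" by (auto simp: matvec.span_singleton)
  obtain c where c: "M' *v v = c *s v" "v \<noteq> 0" using M'(3) by (auto simp: eigenvector_def)
  have "M *v v = k *s (M' *v v)"
    by (simp add: k matrix_scale_def matrix_vector_mult_def vec_eq_iff sum_distrib_left mult.assoc)
  then have "M *v v = (k * c) *s v" by (simp add: c vector_smult_assoc)
  then have "eigenvector M v" using c by (auto simp: eigenvector_def)
  then show "L \<in> eigenpoints M" using M'(2) by (auto simp: eigenpoints_def)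
qed

lemma sig_edges_bipartite:
  "{Inl x, Inl y} \<notin> sig_edges" "{Inr K, Inr L} \<notin> sig_edges"
  by (auto simp: sig_edges_def doubleton_eq_iff)

lemma sig_verts_iff:
  "Inl x \<in> sig_verts \<longleftrightarrow> (\<exists>M\<in>eigen_matrices. x = matvec.span {M})"
  "Inr L \<in> sig_verts \<longleftrightarrow> L \<in> projective_space (*s)"
  by (auto simp: sig_verts_def)

lemma eigenpoints_subset: "eigenpoints M \<subseteq> projective_space (*s)"
  by (auto simp: eigenpoints_def projective_space_iff eigenvector_def)

lemma identity_eigen:
  "(mat 1 :: 'a::field^'n^'n) \<in> eigen_matrices" "eigenpoints (mat 1 :: 'a::field^'n^'n) = projective_space (*s)"
proof -
  have ev: "eigenvector (mat 1) v \<longleftrightarrow> v \<noteq> 0" for v :: "'a^'n"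
    by (auto simp: eigenvector_def intro: exI[of _ 1])
  then show "eigenpoints (mat 1 :: 'a::field^'n^'n) = projective_space (*s)"
    unfolding eigenpoints_def set_eq_iff mem_Collect_eq projective_space_iff by blast
  have "(1 :: 'a^'n) \<noteq> 0" by (simp add: vec_eq_iff)
  moreover have "(mat 1 :: 'a^'n^'n) \<noteq> 0" by (auto simp: mat_def vec_eq_iff)
  ultimately show "(mat 1 :: 'a^'n^'n) \<in> eigen_matrices"
    unfolding eigen_matrices_def mem_Collect_eq ev by blast
qed

text \<open>If the coordinate \<open>v\<^sub>i\<close> is nonzero and \<open>j \<noteq> i\<close>, the matrix unit \<open>x \<mapsto> x\<^sub>i e\<^sub>j\<close> sends \<open>v\<close> to
  a nonzero vector that is not a multiple of \<open>v\<close>. It kills \<open>e\<^sub>j\<close>, so it does have an eigenvector.\<close>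

lemma exists_eigenpoints_avoiding:
  fixes L :: "('a::field^'n) set"
  assumes "CARD('n) \<ge> 2" "L \<in> projective_space (*s)"
  obtains M where "M \<in> eigen_matrices" "L \<notin> eigenpoints M"
proof -
  obtain v where v: "v \<noteq> 0" "L = vec.span {v}" using assms(2) by (auto simp: projective_space_iff)
  then obtain i where i: "v $ i \<noteq> 0" by (auto simp: vec_eq_iff)
  have "\<exists>j. j \<noteq> i"
  proof (rule ccontr)
    assume "\<nexists>j. j \<noteq> i"
    then have "(UNIV :: 'n set) = {i}" by auto
    then have "CARD('n) = card {i}" by metis
    then show False using assms(1) by simp
  qed
  then obtain j where j: "j \<noteq> i" by blast
  define M :: "'a^'n^'n" where "M = (\<chi> a b. if a = j \<and> b = i then 1 else 0)"
  have M: "M *v x = x $ i *s axis j 1" for x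
    by (auto simp: M_def matrix_vector_mult_def vec_eq_iff axis_def if_distrib if_distribR
        sum.delta cong: if_cong)
  have "M $ j $ i = 1" by (simp add: M_def)
  then have "M \<noteq> 0" by auto
  moreover have "eigenvector M (axis j 1)"
    using j by (auto simp: eigenvector_def M axis_eq_0_iff intro: exI[of _ 0])
  ultimately have "M \<in> eigen_matrices" by (auto simp: eigen_matrices_def)
  moreover have "L \<notin> eigenpoints M"
  proof
    assume "L \<in> eigenpoints M"
    then obtain w c where w: "vec.span {v} = vec.span {w}" "w \<noteq> 0" "M *v w = c *s w"
      by (auto simp: eigenpoints_def eigenvector_def v(2))
    have "v \<in> vec.span {w}" using w(1) vec.span_base by blast
    then obtain k where "v = k *s w" by (auto simp: vec.span_singleton)
    then have wi: "w $ i \<noteq> 0" using i by auto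
    have "(M *v w) $ i = c * w $ i" "(M *v w) $ j = c * w $ j" by (simp_all add: w(3))
    then have "c * w $ i = 0" "w $ i = c * w $ j" using j by (auto simp: M axis_def)
    then show False using wi by auto
  qed
  ultimately show ?thesis using that by blast
qed

text \<open>Every vertex is the identity vertex \<open>I\<close>, a neighbour of \<open>I\<close> or, as every matrix vertex has
  a neighbour, at distance two from \<open>I\<close>. So if \<open>\<phi> I\<close> is a matrix vertex, points go to points. If it
  were a point \<open>P\<close>, the parts would be exchanged and \<open>P\<close> adjacent to all matrix vertices.\<close>

lemma sig_automorphism_points:
  fixes \<phi> :: "('a::field, 'n::finite) sig_vertex \<Rightarrow> ('a, 'n) sig_vertex"
  assumes n: "CARD('n) \<ge> 2" and \<phi>: "graph_automorphism sig_verts sig_edges \<phi>"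
    and L: "L \<in> projective_space (*s)"
  shows "\<exists>K\<in>projective_space (*s). \<phi> (Inr L) = Inr K"
proof -
  have bij: "bij_betw \<phi> sig_verts sig_verts"
    and adj: "\<And>x y. x \<in> sig_verts \<Longrightarrow> y \<in> sig_verts \<Longrightarrow> {\<phi> x, \<phi> y} \<in> sig_edges \<longleftrightarrow> {x, y} \<in> sig_edges"
    using \<phi> by (auto simp: graph_automorphism_def)
  define I :: "('a, 'n) sig_vertex" where "I = Inl (matvec.span {mat 1})"
  have I: "I \<in> sig_verts" using identity_eigen(1) by (auto simp: I_def sig_verts_iff)
  have I_adj: "{I, Inr K} \<in> sig_edges" if "K \<in> projective_space (*s)" for K
    using that identity_eigen(2) sig_edge_iff[OF identity_eigen(1)] by (auto simp: I_def)
  have \<phi>I: "\<phi> I \<in> sig_verts" using bij I by (auto simp: bij_betw_def)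
  have nb: "{\<phi> I, \<phi> (Inr K)} \<in> sig_edges" if "K \<in> projective_space (*s)" for K
    using that adj[OF I] I_adj by (simp add: sig_verts_iff)
  show ?thesis
  proof (cases "\<phi> I")
    case (Inl x)
    have "\<phi> (Inr L) \<in> sig_verts" using bij L by (auto simp: bij_betw_def sig_verts_iff)
    then show ?thesis
      using nb[OF L] Inl sig_edges_bipartite(1) by (cases "\<phi> (Inr L)") (auto simp: sig_verts_iff)
  next
    case (Inr P)
    then have P: "P \<in> projective_space (*s)" using \<phi>I by (simp add: sig_verts_iff)
    obtain M where M: "M \<in> eigen_matrices" "P \<notin> eigenpoints M"
      by (rule exists_eigenpoints_avoiding[OF n P])
    have "Inl (matvec.span {M}) \<in> sig_verts" using M(1) by (auto simp: sig_verts_iff)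
    then obtain y where y: "y \<in> sig_verts" "\<phi> y = Inl (matvec.span {M})"
      using bij_betw_imp_surj_on[OF bij] by (metis imageE)
    \<comment> \<open>A point \<open>y\<close> is adjacent to \<open>I\<close>, which makes \<open>M\<close> adjacent to \<open>P\<close>. A matrix vertex \<open>y\<close> has a
      neighbour \<open>K\<close>, whose image would be adjacent both to the point \<open>P\<close> and to the vertex of \<open>M\<close>.\<close>
    have False
    proof (cases y)
      case (Inr K)
      then have "{Inr P, Inl (matvec.span {M})} \<in> sig_edges"
        using nb[of K] y \<open>\<phi> I = Inr P\<close> by (simp add: sig_verts_iff)
      then show False using M sig_edge_iff[OF M(1)] by (simp add: insert_commute)
    next
      case (Inl x)
      then obtain N where N: "N \<in> eigen_matrices" "x = matvec.span {N}"
        using y(1) by (auto simp: sig_verts_iff)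
      then obtain K where K: "K \<in> eigenpoints N"
        by (auto simp: eigen_matrices_def eigenpoints_def)
      then have Kp: "K \<in> projective_space (*s)" using eigenpoints_subset by blast
      have "{y, Inr K} \<in> sig_edges" using K N Inl sig_edge_iff by blast
      then have e: "{\<phi> y, \<phi> (Inr K)} \<in> sig_edges"
        using adj[OF y(1)] Kp by (simp add: sig_verts_iff)
      show False
        using e nb[OF Kp] y(2) \<open>\<phi> I = Inr P\<close> sig_edges_bipartite
        by (cases "\<phi> (Inr K)") auto
    qed
    then show ?thesis ..
  qed
qed

theorem theorem3p5:
  fixes \<phi> :: "('a::{field,finite}, 'n::finite) sig_vertex \<Rightarrow> ('a, 'n) sig_vertex"
  assumes "CARD('n) \<ge> 2"
    and "graph_automorphism sig_verts sig_edges \<phi>"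
  shows "\<exists>f :: ('a^'n) set \<Rightarrow> ('a^'n) set.
    (\<forall>L\<in>projective_space (*s). \<phi> (Inr L) = Inr (f L)) \<and> collineation (*s) f"
proof -
  let ?P = "projective_space (*s) :: ('a^'n) set set"
  have bij: "bij_betw \<phi> sig_verts sig_verts"
    and adj: "\<And>x y. x \<in> sig_verts \<Longrightarrow> y \<in> sig_verts \<Longrightarrow> {\<phi> x, \<phi> y} \<in> sig_edges \<longleftrightarrow> {x, y} \<in> sig_edges"
    using assms(2) by (auto simp: graph_automorphism_def)
  obtain f where f: "\<And>L. L \<in> ?P \<Longrightarrow> f L \<in> ?P \<and> \<phi> (Inr L) = Inr (f L)"
    using sig_automorphism_points[OF assms] by metis
  have "inj_on f ?P"
  proof (rule inj_onI)
    fix K L assume "K \<in> ?P" "L \<in> ?P" "f K = f L"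
    then have "\<phi> (Inr K) = \<phi> (Inr L)" "Inr K \<in> sig_verts" "Inr L \<in> sig_verts"
      using f by (auto simp: sig_verts_iff)
    then show "K = L" using bij by (auto simp: bij_betw_def dest: inj_onD)
  qed
  moreover from this have "f ` ?P = ?P"
    using f by (intro endo_inj_surj) auto
  ultimately have fbij: "bij_betw f ?P ?P" by (simp add: bij_betw_def)
  have image: "eigenpoints N = f ` eigenpoints M"
    if "M \<in> eigen_matrices" "N \<in> eigen_matrices" "\<phi> (Inl (matvec.span {M})) = Inl (matvec.span {N})"
    for M N
  proof -
    have "f K \<in> eigenpoints N \<longleftrightarrow> K \<in> eigenpoints M" if "K \<in> ?P" for K
      using adj[of "Inl (matvec.span {M})" "Inr K"] that
        \<open>M \<in> _\<close> \<open>N \<in> _\<close> \<open>\<phi> _ = _\<close> f[of K] sig_edge_iff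
      by (auto simp: sig_verts_iff)
    moreover have "eigenpoints N \<subseteq> f ` ?P" using eigenpoints_subset \<open>f ` ?P = ?P\<close> by auto
    ultimately show ?thesis using eigenpoints_subset[of M] by blast
  qed
  \<comment> \<open>The points are already exhausted as images of points, so \<open>\<phi>\<close> permutes the matrix vertices.\<close>
  have fwd: "\<exists>N\<in>eigen_matrices. \<phi> (Inl (matvec.span {M})) = Inl (matvec.span {N})"
    if M: "M \<in> eigen_matrices" for M
  proof (cases "\<phi> (Inl (matvec.span {M}))")
    case (Inl x)
    have "\<phi> (Inl (matvec.span {M})) \<in> sig_verts"
      using M by (intro bij_betw_apply[OF bij]) (auto simp: sig_verts_iff)
    then show ?thesis using Inl by (auto simp: sig_verts_iff)
  next
    case (Inr K)
    have "\<phi> (Inl (matvec.span {M})) \<in> sig_verts"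
      using M by (intro bij_betw_apply[OF bij]) (auto simp: sig_verts_iff)
    then have "K \<in> f ` ?P" using Inr \<open>f ` ?P = ?P\<close> by (simp add: sig_verts_iff)
    then obtain L where L: "L \<in> ?P" "K = f L" by blast
    then have "\<phi> (Inl (matvec.span {M})) = \<phi> (Inr L)" using f Inr by simp
    moreover have "Inl (matvec.span {M}) \<in> sig_verts" "Inr L \<in> sig_verts"
      using M L by (auto simp: sig_verts_iff)
    ultimately have "(Inl (matvec.span {M}) :: ('a,'n) sig_vertex) = Inr L"
      using bij by (meson bij_betw_def inj_onD)
    then show ?thesis by simp
  qed
  have bwd: "\<exists>M\<in>eigen_matrices. \<phi> (Inl (matvec.span {M})) = Inl (matvec.span {N})"
    if N: "N \<in> eigen_matrices" for N
  proof -
    have "Inl (matvec.span {N}) \<in> sig_verts" using N by (auto simp: sig_verts_iff)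
    then obtain y where y: "y \<in> sig_verts" "\<phi> y = Inl (matvec.span {N})"
      using bij_betw_imp_surj_on[OF bij] by (metis imageE)
    then show ?thesis using f by (cases y) (auto simp: sig_verts_iff)
  qed
  have card_image: "card (f ` eigenpoints M) = card (eigenpoints M)" for M
    using \<open>inj_on f ?P\<close> eigenpoints_subset by (metis card_image inj_on_subset)
  have mem_image: "f L \<in> f ` eigenpoints M \<longleftrightarrow> L \<in> eigenpoints M" if "L \<in> ?P" for L M
    using \<open>inj_on f ?P\<close> eigenpoints_subset that by (metis inj_on_image_mem_iff)
  \<comment> \<open>Replace both incidences by the degree criterion and transport the matrix along \<open>\<phi>\<close>.\<close>
  have "L3 \<subseteq> {x + y | x y. x \<in> L1 \<and> y \<in> L2} \<longleftrightarrow>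
      f L3 \<subseteq> {x + y | x y. x \<in> f L1 \<and> y \<in> f L2}"
    if L: "L1 \<in> ?P" "L2 \<in> ?P" "L3 \<in> ?P" and ne: "L1 \<noteq> L2" for L1 L2 L3
  proof -
    have "f L1 \<noteq> f L2" using L ne \<open>inj_on f ?P\<close> by (auto dest: inj_onD)
    then have "f L3 \<subseteq> {x + y | x y. x \<in> f L1 \<and> y \<in> f L2} \<longleftrightarrow>
        (\<exists>N\<in>eigen_matrices. card (eigenpoints N) = CARD('a) + 1 \<and>
          {f L1, f L2, f L3} \<subseteq> eigenpoints N)"
      using f L by (intro collinear_iff_eigenpoints) auto
    also have "\<dots> \<longleftrightarrow> (\<exists>M\<in>eigen_matrices. card (f ` eigenpoints M) = CARD('a) + 1 \<and>
          {f L1, f L2, f L3} \<subseteq> f ` eigenpoints M)"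
    proof
      assume "\<exists>N\<in>eigen_matrices. card (eigenpoints N) = CARD('a) + 1 \<and>
          {f L1, f L2, f L3} \<subseteq> eigenpoints N"
      then obtain N where N: "N \<in> eigen_matrices" "card (eigenpoints N) = CARD('a) + 1"
          "{f L1, f L2, f L3} \<subseteq> eigenpoints N" by blast
      obtain M where M: "M \<in> eigen_matrices"
          "\<phi> (Inl (matvec.span {M})) = Inl (matvec.span {N})" using bwd[OF N(1)] by blast
      show "\<exists>M\<in>eigen_matrices. card (f ` eigenpoints M) = CARD('a) + 1 \<and>
          {f L1, f L2, f L3} \<subseteq> f ` eigenpoints M"
        using M(1) N(2,3) unfolding image[OF M(1) N(1) M(2)] by blast
    next
      assume "\<exists>M\<in>eigen_matrices. card (f ` eigenpoints M) = CARD('a) + 1 \<and>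
          {f L1, f L2, f L3} \<subseteq> f ` eigenpoints M"
      then obtain M where M: "M \<in> eigen_matrices" "card (f ` eigenpoints M) = CARD('a) + 1"
          "{f L1, f L2, f L3} \<subseteq> f ` eigenpoints M" by blast
      obtain N where N: "N \<in> eigen_matrices"
          "\<phi> (Inl (matvec.span {M})) = Inl (matvec.span {N})" using fwd[OF M(1)] by blast
      show "\<exists>N\<in>eigen_matrices. card (eigenpoints N) = CARD('a) + 1 \<and>
          {f L1, f L2, f L3} \<subseteq> eigenpoints N"
        using N(1) M(2,3) unfolding image[OF M(1) N(1) N(2), symmetric] by blast
    qed
    also have "\<dots> \<longleftrightarrow> (\<exists>M\<in>eigen_matrices. card (eigenpoints M) = CARD('a) + 1 \<and>
          {L1, L2, L3} \<subseteq> eigenpoints M)"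
      using L by (simp add: card_image mem_image)
    also have "\<dots> \<longleftrightarrow> L3 \<subseteq> {x + y | x y. x \<in> L1 \<and> y \<in> L2}"
      using L ne by (intro collinear_iff_eigenpoints[symmetric]) auto
    finally show ?thesis by blast
  qed
  then have "collineation (*s) f"
    using fbij unfolding collineation_def by auto
  then show ?thesis using f by blast
qed

end
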